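(* Suppose that at every step of the joint bidiagonalization (JBD) process the inner least squares problem is solved accurately. Then the quantities computed by the $k$-step JBD process in finite precision satisfy $$Q_A V_k = U_{k+1}B_k + F_k ,\qquad Q_A^T U_{k+1} = V_k B_k^T + \alpha_{k+1} v_{k+1} e_{k+1}^T + G_{k+1},$$ where $G_{k+1}=Q^T\widetilde G_{k+1}$ and $$\|F_k\| = O(\|\underline{B}_k^{-1}\|\epsilon),\qquad \|G_{k+1}\| = O(\epsilon).$$
   Context: Setting. $A\in\mathbb{R}^{m\times n}$, $L\in\mathbb{R}^{p\times n}$ with $\mathrm{rank}\begin{pmatrix}A\\L\end{pmatrix}=n$. The compact QR factorization is $\begin{pmatrix}A\\L\end{pmatrix}=QR$ with $Q=\begin{pmatrix}Q_A\\Q_L\end{pmatrix}$, $Q^TQ=I_n$, $Q_A\in\mathbb{R}^{m\times n}$, $Q_L\in\mathbb{R}^{p\times n}$, $R\in\mathbb{R}^{n\times n}$ nonsingular. $\|\cdot\|$ is the 2-norm, $\epsilon$ is the unit roundoff, and $e_j$ with $j=k$ or $k+1$ is the last column of $I_j$. JBD process (exact form). $\beta_1u_1=b$; $\alpha_1\tilde v_1=QQ^T(u_1^T,0_p^T)^T$; and for $i\ge 1$: $\beta_{i+1}u_{i+1}=\tilde v_i(1{:}m)-\alpha_iu_i$; $\alpha_{i+1}\tilde v_{i+1}=QQ^T(u_{i+1}^T,0_p^T)^T-\beta_{i+1}\tilde v_i$. The vector $QQ^T(u_i^T,0_p^T)^T$ is obtained by solving the inner least squares problem $\min_x\|\begin{pmatrix}A\\L\end{pmatrix}x-\begin{pmatrix}u_i\\0_p\end{pmatrix}\|$.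 Notation (computed quantities). $U_{k+1}=(u_1,\dots,u_{k+1})\in\mathbb{R}^{m\times(k+1)}$, $\widetilde V_k=(\tilde v_1,\dots,\tilde v_k)\in\mathbb{R}^{(m+p)\times k}$; all $u_i,\tilde v_i$ have unit length. $B_k\in\mathbb{R}^{(k+1)\times k}$ is lower bidiagonal with diagonal $\alpha_1,\dots,\alpha_k$ and subdiagonal $\beta_2,\dots,\beta_{k+1}$. $\underline{B}_k=\begin{pmatrix}B_{k-1}^T\\ \alpha_ke_k^T\end{pmatrix}\in\mathbb{R}^{k\times k}$ is upper bidiagonal with diagonal $\alpha_1,\dots,\alpha_k$ and superdiagonal $\beta_2,\dots,\beta_k$, assumed invertible. $v_i=Q^T\tilde v_i$ and $V_k=(v_1,\dots,v_k)$. Finite precision model (with accurate inner solves). The computed quantities satisfy $(I_m,0_{m\times p})\widetilde V_k=U_{k+1}B_k+\widetilde F_k$ and $QQ^T\begin{pmatrix}U_{k+1}\\0_{p\times(k+1)}\end{pmatrix}=\widetilde V_kB_k^T+\alpha_{k+1}\tilde v_{k+1}e_{k+1}^T+\widetilde G_{k+1}$, with $\|\widetilde F_k\|,\|\widetilde G_{k+1}\|=O(\epsilon)$. Local orthogonality: $\beta_{i+1}|u_{i+1}^Tu_i|=O(c_1\epsilon)$, with $c_1=c_1(m,n)$ a modest constant; no $\beta_{i+1}$ is negligible. Convention. $X=O(Y)$ means $|X|\le KY$ for a modest constant $K$ that does not depend on $\epsilon$ or on $\|\underline B_k^{-1}\|$ (it may depend on $k$ and $c_1$), with $\epsilon$ sufficiently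 small. *)

theory Defs
  imports
    "Jordan_Normal_Form.DL_Rank"
    "Jordan_Normal_Form.Gauss_Jordan_Elimination"
    Complex_Main
begin

definition vec_norm2 :: "real vec \<Rightarrow> real" where
  "vec_norm2 x = sqrt (x \<bullet> x)"

text \<open>The spectral norm, as operator norm. The unit ball rather than the unit sphere is used so
  that the supremum is over a nonempty set also for matrices without columns.\<close>

definition mat_norm2 :: "real mat \<Rightarrow> real" where
  "mat_norm2 M = Sup {vec_norm2 (M *\<^sub>v x) | x. x \<in> carrier_vec (dim_col M) \<and> vec_norm2 x \<le> 1}"

definition mat_inv :: "real mat \<Rightarrow> real mat" where
  "mat_inv M = the (mat_inverse M)"

definition outer :: "real vec \<Rightarrow> real vec \<Rightarrow> real mat" where
  "outer x y = mat (dim_vec x) (dim_vec y) (\<lambda>(i, j). x $ i * y $ j)"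

text \<open>\<open>cols_upto d x j\<close> is the \<open>d \<times> j\<close> matrix with columns \<open>x 1, \<dots>, x j\<close>. Families of vectors
  and scalars are indexed from 1, whereas matrix entries are indexed from 0.\<close>

definition cols_upto :: "nat \<Rightarrow> (nat \<Rightarrow> real vec) \<Rightarrow> nat \<Rightarrow> real mat" where
  "cols_upto d x j = mat_of_cols d (map x [1..<Suc j])"

definition last_unit :: "nat \<Rightarrow> real vec" where
  "last_unit j = unit_vec j (j - 1)"

text \<open>The \<open>(k+1) \<times> k\<close> lower bidiagonal matrix with diagonal \<open>\<alpha> 1, \<dots>, \<alpha> k\<close> and subdiagonal
  \<open>\<beta> 2, \<dots>, \<beta> (k+1)\<close>; with entries indexed from 0, row \<open>i\<close> holds \<open>\<alpha> (i+1)\<close> and \<open>\<beta> (i+1)\<close>.\<close>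

definition lower_bidiag :: "(nat \<Rightarrow> real) \<Rightarrow> (nat \<Rightarrow> real) \<Rightarrow> nat \<Rightarrow> real mat" where
  "lower_bidiag \<alpha> \<beta> k = mat (k + 1) k
     (\<lambda>(i, j). if i = j then \<alpha> (i + 1) else if i = j + 1 then \<beta> (i + 1) else 0)"

text \<open>The matrix written as underlined \<open>B\<^sub>k\<close>: upper bidiagonal of size \<open>k \<times> k\<close> with diagonal
  \<open>\<alpha> 1, \<dots>, \<alpha> k\<close> and superdiagonal \<open>\<beta> 2, \<dots>, \<beta> k\<close>. Meaningful only for \<open>k \<ge> 1\<close>.\<close>

definition upper_bidiag :: "(nat \<Rightarrow> real) \<Rightarrow> (nat \<Rightarrow> real) \<Rightarrow> nat \<Rightarrow> real mat" where
  "upper_bidiag \<alpha> \<beta> k =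
     transpose_mat (lower_bidiag \<alpha> \<beta> (k - 1)) @\<^sub>r mat_of_rows k [\<alpha> k \<cdot>\<^sub>v last_unit k]"

locale compact_qr =
  fixes m n p :: nat and A L QA QL R :: "real mat"
  assumes A_carrier: "A \<in> carrier_mat m n"
    and L_carrier: "L \<in> carrier_mat p n"
    and full_rank: "vec_space.rank (m + p) (A @\<^sub>r L) = n"
    and QA_carrier: "QA \<in> carrier_mat m n"
    and QL_carrier: "QL \<in> carrier_mat p n"
    and R_carrier: "R \<in> carrier_mat n n"
    and R_upper: "upper_triangular R"
    and R_nonsingular: "invertible_mat R"
    and factorization: "A @\<^sub>r L = (QA @\<^sub>r QL) * R"
    and orthonormal: "transpose_mat (QA @\<^sub>r QL) * (QA @\<^sub>r QL) = 1\<^sub>m n"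

text \<open>The finite precision model of \<open>k\<close> steps of joint bidiagonalization with accurate inner
  solves. Here \<open>\<epsilon>\<close> is the unit roundoff, \<open>C\<close> is the constant hidden in the \<open>O\<close>-terms of the
  model, \<open>u i\<close>, \<open>vt i\<close>, \<open>\<alpha> i\<close>, \<open>\<beta> i\<close> are the computed quantities (\<open>vt i\<close> has length \<open>m + p\<close>),
  and \<open>Ft\<close>, \<open>Gt\<close> are the residuals of the two matrix recurrences. In these,
  \<open>transpose_mat (1\<^sub>m m @\<^sub>r 0\<^sub>m p m)\<close> is the block matrix \<open>(I\<^sub>m, 0)\<close>. That no \<open>\<beta> (i+1)\<close> is
  negligible is rendered by positivity only, without any quantitative lower bound.\<close>

locale jbd_finite_precision = compact_qr m n p A L QA QL R
  for m n p :: nat and A L QA QL R :: "real mat" +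
  fixes k :: nat and c1 C \<epsilon> :: real
    and u vt :: "nat \<Rightarrow> real vec" and \<alpha> \<beta> :: "nat \<Rightarrow> real" and Ft Gt :: "real mat"
  assumes u_carrier: "i \<in> {1..k+1} \<Longrightarrow> u i \<in> carrier_vec m"
    and vt_carrier: "i \<in> {1..k+1} \<Longrightarrow> vt i \<in> carrier_vec (m + p)"
    and u_unit: "i \<in> {1..k+1} \<Longrightarrow> vec_norm2 (u i) = 1"
    and vt_unit: "i \<in> {1..k+1} \<Longrightarrow> vec_norm2 (vt i) = 1"
    and B_invertible: "invertible_mat (upper_bidiag \<alpha> \<beta> k)"
    and Ft_carrier: "Ft \<in> carrier_mat m k"
    and Gt_carrier: "Gt \<in> carrier_mat (m + p) (k + 1)"
    and recurrence_u:
      "transpose_mat (1\<^sub>m m @\<^sub>r 0\<^sub>m p m) * cols_upto (m + p) vt k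
         = cols_upto m u (k + 1) * lower_bidiag \<alpha> \<beta> k + Ft"
    and recurrence_vt:
      "(QA @\<^sub>r QL) * transpose_mat (QA @\<^sub>r QL) * (cols_upto m u (k + 1) @\<^sub>r 0\<^sub>m p (k + 1))
         = cols_upto (m + p) vt k * transpose_mat (lower_bidiag \<alpha> \<beta> k)
           + \<alpha> (k + 1) \<cdot>\<^sub>m outer (vt (k + 1)) (last_unit (k + 1)) + Gt"
    and Ft_bound: "mat_norm2 Ft \<le> C * \<epsilon>"
    and Gt_bound: "mat_norm2 Gt \<le> C * \<epsilon>"
    and beta_not_negligible: "i \<in> {1..k} \<Longrightarrow> 0 < \<beta> (i + 1)"
    and local_orthogonality: "i \<in> {1..k} \<Longrightarrow> \<beta> (i + 1) * \<bar>u (i + 1) \<bullet> u i\<bar> \<le> C * (c1 * \<epsilon>)"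

end

theory Submission
  imports Defs "HOL-Analysis.L2_Norm"
begin

text \<open>Write \<open>Q\<close> for the orthonormal factor, with upper block \<open>QA\<close>, and \<open>H = Q * Q\<^sup>T\<close> for the
  orthogonal projection onto its column space; let \<open>S\<close> be the identity of size \<open>m\<close> with \<open>p\<close> zero
  rows below it, so that \<open>S\<^sup>T * Q = QA\<close>. The projected vectors are the columns of \<open>V = Q\<^sup>T * Vt\<close>.

  The recurrence for \<open>QA\<^sup>T\<close> is the second recurrence of the model multiplied by \<open>Q\<^sup>T\<close>: since
  \<open>Q\<^sup>T * H = Q\<^sup>T\<close>, its left-hand side becomes \<open>(S\<^sup>T * Q)\<^sup>T * U\<close>. The residual is \<open>Q\<^sup>T * Gt\<close>, and
  \<open>Q\<^sup>T\<close> is a contraction (\<open>recurrence_QA_transpose\<close>, \<open>mat_norm2_residual_vt_le\<close>).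

  In the other recurrence \<open>QA * V = S\<^sup>T * H * Vt\<close>, whereas the model controls \<open>S\<^sup>T * Vt\<close>. So
  everything depends on how far the computed columns of \<open>Vt\<close> have drifted out of the column space
  of \<open>Q\<close>. The second recurrence answers this: its first \<open>k\<close> columns read
  \<open>H * W = Vt * T + G'\<close>, where \<open>W\<close> is the padded matrix of the first \<open>k\<close> vectors \<open>u\<close>, \<open>T\<close> is the
  upper bidiagonal matrix of size \<open>k\<close> and \<open>G'\<close> collects the first \<open>k\<close> columns of \<open>Gt\<close>
  (\<open>recurrence_vt_first_columns\<close>). The complementary projection \<open>1 - H\<close> kills the left-hand side,
  so \<open>(1 - H) * Vt = - (1 - H) * G' * T\<^sup>-\<^sup>1\<close> (\<open>projection_mult_eq\<close>). This is where the factor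
  \<open>\<parallel>T\<^sup>-\<^sup>1\<parallel>\<close> in the error bound originates. It follows that \<open>F = Ft + S\<^sup>T * (1 - H) * G' * T\<^sup>-\<^sup>1\<close>, of
  norm at most \<open>C * \<epsilon> + C * \<epsilon> * \<parallel>T\<^sup>-\<^sup>1\<parallel>\<close> (\<open>residual_u\<close>).

  It remains to absorb the summand \<open>C * \<epsilon>\<close>, for which \<open>\<parallel>T\<^sup>-\<^sup>1\<parallel>\<close> must not be small. The first
  unit vector is an eigenvector of \<open>T\<close> with eigenvalue \<open>\<alpha> 1\<close>, so \<open>1 \<le> \<bar>\<alpha> 1\<bar> * \<parallel>T\<^sup>-\<^sup>1\<parallel>\<close>; and the
  first column of the second recurrence shows \<open>\<bar>\<alpha> 1\<bar> \<le> 1 + C * \<epsilon>\<close> because \<open>u 1\<close> and \<open>vt 1\<close> are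
  unit vectors (\<open>abs_alpha_1_le\<close>, \<open>one_le_mat_norm2_inverse\<close>).\<close>

section \<open>The Euclidean norm of a vector\<close>

lemma vec_norm2_eq_L2_set: "vec_norm2 x = L2_set (($) x) {0..<dim_vec x}"
  by (simp add: vec_norm2_def L2_set_def scalar_prod_def power2_eq_square)

lemma vec_norm2_nonneg [simp]: "0 \<le> vec_norm2 x"
  by (simp add: vec_norm2_eq_L2_set L2_set_nonneg)

lemma vec_norm2_squared: "vec_norm2 x * vec_norm2 x = x \<bullet> x"
  by (simp add: vec_norm2_def scalar_prod_def sum_nonneg)

lemma scalar_prod_le_vec_norm2:
  assumes "x \<in> carrier_vec n" "y \<in> carrier_vec n"
  shows "x \<bullet> y \<le> vec_norm2 x * vec_norm2 y"
proof -
  have "x \<bullet> y \<le> (\<Sum>i\<in>{0..<n}. \<bar>x $ i\<bar> * \<bar>y $ i\<bar>)"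
    using assms by (auto simp: scalar_prod_def abs_mult[symmetric] intro!: sum_mono)
  also have "\<dots> \<le> vec_norm2 x * vec_norm2 y"
    using assms L2_set_mult_ineq[of "($) x" "($) y" "{0..<n}"]
    by (simp add: vec_norm2_eq_L2_set)
  finally show ?thesis .
qed

lemma vec_norm2_add_le:
  assumes "x \<in> carrier_vec n" "y \<in> carrier_vec n"
  shows "vec_norm2 (x + y) \<le> vec_norm2 x + vec_norm2 y"
proof -
  have "vec_norm2 (x + y) = L2_set (\<lambda>i. x $ i + y $ i) {0..<n}"
    using assms by (auto simp: vec_norm2_eq_L2_set intro!: L2_set_cong)
  also have "\<dots> \<le> vec_norm2 x + vec_norm2 y"
    using assms L2_set_triangle_ineq[of "($) x" "($) y" "{0..<n}"]
    by (simp add: vec_norm2_eq_L2_set)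
  finally show ?thesis .
qed

lemma vec_norm2_smult: "vec_norm2 (c \<cdot>\<^sub>v x) = \<bar>c\<bar> * vec_norm2 x"
proof -
  have "(c \<cdot>\<^sub>v x) \<bullet> (c \<cdot>\<^sub>v x) = c\<^sup>2 * (x \<bullet> x)"
    by (simp add: power2_eq_square)
  then show ?thesis by (simp add: vec_norm2_def real_sqrt_mult)
qed

lemma vec_norm2_uminus: "vec_norm2 (- x) = vec_norm2 x"
  by (simp add: vec_norm2_def scalar_prod_def)

lemma vec_norm2_unit_vec:
  assumes "i < n"
  shows "vec_norm2 (unit_vec n i) = 1"
  using assms by (simp add: vec_norm2_def)

lemma vec_norm2_eq_0:
  assumes "vec_norm2 x = 0"
  shows "x = 0\<^sub>v (dim_vec x)"
  using assms by (auto simp: vec_norm2_eq_L2_set L2_set_eq_0_iff intro!: eq_vecI)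

lemma scalar_prod_mult_mat_vec:
  fixes M :: "real mat"
  assumes "M \<in> carrier_mat m n" "x \<in> carrier_vec n" "y \<in> carrier_vec m"
  shows "(M *\<^sub>v x) \<bullet> y = x \<bullet> (transpose_mat M *\<^sub>v y)"
proof -
  have "(M *\<^sub>v x) \<bullet> y = y \<bullet> (M *\<^sub>v x)"
    using assms by (intro comm_scalar_prod[of _ m]) auto
  also have "\<dots> = (transpose_mat M *\<^sub>v y) \<bullet> x"
    using assms by (simp add: transpose_vec_mult_scalar)
  also have "\<dots> = x \<bullet> (transpose_mat M *\<^sub>v y)"
    using assms by (intro comm_scalar_prod[of _ n]) auto
  finally show ?thesis .
qed

section \<open>The spectral norm of a matrix\<close>

text \<open>A supremum of an unbounded set of reals carries no information, so every upper bound by the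
  spectral norm rests on boundedness; here it comes from applying Cauchy--Schwarz to each row.\<close>

lemma mat_norm2_bdd_above:
  "bdd_above {vec_norm2 (M *\<^sub>v x) | x. x \<in> carrier_vec (dim_col M) \<and> vec_norm2 x \<le> 1}"
proof (rule bdd_aboveI, clarsimp)
  fix x assume x: "x \<in> carrier_vec (dim_col M)" "vec_norm2 x \<le> 1"
  have entry: "\<bar>(M *\<^sub>v x) $ i\<bar> \<le> vec_norm2 (row M i)" if "i < dim_row M" for i
  proof -
    have "row M i \<bullet> x \<le> vec_norm2 (row M i) * vec_norm2 x"
      using x by (intro scalar_prod_le_vec_norm2[of _ "dim_col M"]) auto
    moreover have "- (row M i \<bullet> x) \<le> vec_norm2 (row M i) * vec_norm2 x"
      using x scalar_prod_le_vec_norm2[of "- row M i" "dim_col M" x]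
      by (simp add: vec_norm2_uminus)
    moreover have "vec_norm2 (row M i) * vec_norm2 x \<le> vec_norm2 (row M i)"
      using x by (simp add: mult_left_le)
    ultimately show ?thesis using that by simp
  qed
  have "vec_norm2 (M *\<^sub>v x) \<le> (\<Sum>i<dim_row M. \<bar>(M *\<^sub>v x) $ i\<bar>)"
    using L2_set_le_sum_abs[of "($) (M *\<^sub>v x)" "{0..<dim_row M}"]
    by (simp add: vec_norm2_eq_L2_set atLeast0LessThan)
  also have "\<dots> \<le> (\<Sum>i<dim_row M. vec_norm2 (row M i))"
    using entry by (intro sum_mono) auto
  finally show "vec_norm2 (M *\<^sub>v x) \<le> (\<Sum>i<dim_row M. vec_norm2 (row M i))" .
qed

lemma vec_norm2_mult_mat_vec_le:
  assumes M: "M \<in> carrier_mat m n" and x: "x \<in> carrier_vec n"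
  shows "vec_norm2 (M *\<^sub>v x) \<le> mat_norm2 M * vec_norm2 x"
proof (cases "vec_norm2 x = 0")
  case True
  then have "x = 0\<^sub>v n" using vec_norm2_eq_0[of x] x by simp
  then have "M *\<^sub>v x = 0\<^sub>v m" using M by auto
  then show ?thesis using True by (simp add: vec_norm2_def)
next
  case False
  define c where "c = vec_norm2 x"
  have c: "0 < c" using False by (simp add: c_def less_le)
  have "(1 / c) \<cdot>\<^sub>v x \<in> carrier_vec (dim_col M) \<and> vec_norm2 ((1 / c) \<cdot>\<^sub>v x) \<le> 1"
    using M x c by (simp add: vec_norm2_smult flip: c_def)
  then have "vec_norm2 (M *\<^sub>v ((1 / c) \<cdot>\<^sub>v x)) \<le> mat_norm2 M"
    unfolding mat_norm2_def by (intro cSup_upper mat_norm2_bdd_above) blast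
  moreover have "M *\<^sub>v ((1 / c) \<cdot>\<^sub>v x) = (1 / c) \<cdot>\<^sub>v (M *\<^sub>v x)"
    using mult_mat_vec[OF M x] .
  ultimately show ?thesis using c by (simp add: vec_norm2_smult c_def[symmetric] field_simps)
qed

lemma vec_norm2_contraction_le:
  assumes "M \<in> carrier_mat m n" "x \<in> carrier_vec n" "mat_norm2 M \<le> 1"
  shows "vec_norm2 (M *\<^sub>v x) \<le> vec_norm2 x"
  using vec_norm2_mult_mat_vec_le[OF assms(1,2)] mult_right_mono[OF assms(3), of "vec_norm2 x"]
  by simp

lemma mat_norm2_leI:
  assumes M: "M \<in> carrier_mat m n" and c: "0 \<le> c"
    and bound: "\<And>x. x \<in> carrier_vec n \<Longrightarrow> vec_norm2 (M *\<^sub>v x) \<le> c * vec_norm2 x"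
  shows "mat_norm2 M \<le> c"
  unfolding mat_norm2_def
proof (rule cSup_least)
  have "0\<^sub>v (dim_col M) \<in> carrier_vec (dim_col M) \<and> vec_norm2 (0\<^sub>v (dim_col M)) \<le> 1"
    by (simp add: vec_norm2_def)
  then show "{vec_norm2 (M *\<^sub>v x) | x. x \<in> carrier_vec (dim_col M) \<and> vec_norm2 x \<le> 1} \<noteq> {}"
    by blast
next
  fix r assume "r \<in> {vec_norm2 (M *\<^sub>v x) | x. x \<in> carrier_vec (dim_col M) \<and> vec_norm2 x \<le> 1}"
  then obtain x where x: "x \<in> carrier_vec n" "vec_norm2 x \<le> 1" and r: "r = vec_norm2 (M *\<^sub>v x)"
    using M by auto
  have "r \<le> c * vec_norm2 x" using bound x r by simp
  also have "\<dots> \<le> c" using x c by (simp add: mult_left_le)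
  finally show "r \<le> c" .
qed

lemma mat_norm2_nonneg [simp]: "0 \<le> mat_norm2 M"
proof -
  have "0\<^sub>v (dim_col M) \<in> carrier_vec (dim_col M) \<and> vec_norm2 (0\<^sub>v (dim_col M)) \<le> 1"
    by (simp add: vec_norm2_def)
  then have "vec_norm2 (M *\<^sub>v 0\<^sub>v (dim_col M)) \<le> mat_norm2 M"
    unfolding mat_norm2_def by (intro cSup_upper mat_norm2_bdd_above) blast
  then show ?thesis using vec_norm2_nonneg order_trans by blast
qed

lemma mat_norm2_mult_le:
  assumes M: "M \<in> carrier_mat m n" and N: "N \<in> carrier_mat n l"
  shows "mat_norm2 (M * N) \<le> mat_norm2 M * mat_norm2 N"
proof (rule mat_norm2_leI)
  show "M * N \<in> carrier_mat m l" using M N by simp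
next
  fix x :: "real vec" assume x: "x \<in> carrier_vec l"
  have "vec_norm2 (M * N *\<^sub>v x) = vec_norm2 (M *\<^sub>v (N *\<^sub>v x))" using M N x by simp
  also have "\<dots> \<le> mat_norm2 M * vec_norm2 (N *\<^sub>v x)"
    using M N x by (intro vec_norm2_mult_mat_vec_le) auto
  also have "\<dots> \<le> mat_norm2 M * (mat_norm2 N * vec_norm2 x)"
    using N x by (intro mult_left_mono vec_norm2_mult_mat_vec_le) auto
  finally show "vec_norm2 (M * N *\<^sub>v x) \<le> mat_norm2 M * mat_norm2 N * vec_norm2 x"
    by (simp add: mult.assoc)
qed simp

lemma mat_norm2_add_le:
  assumes M: "M \<in> carrier_mat m n" and N: "N \<in> carrier_mat m n"
  shows "mat_norm2 (M + N) \<le> mat_norm2 M + mat_norm2 N"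
proof (rule mat_norm2_leI)
  show "M + N \<in> carrier_mat m n" using M N by simp
next
  fix x :: "real vec" assume x: "x \<in> carrier_vec n"
  have "vec_norm2 ((M + N) *\<^sub>v x) = vec_norm2 (M *\<^sub>v x + N *\<^sub>v x)"
    using M N x by (simp add: add_mult_distrib_mat_vec)
  also have "\<dots> \<le> vec_norm2 (M *\<^sub>v x) + vec_norm2 (N *\<^sub>v x)"
    using M N x by (intro vec_norm2_add_le[of _ m]) auto
  also have "\<dots> \<le> mat_norm2 M * vec_norm2 x + mat_norm2 N * vec_norm2 x"
    using M N x by (intro add_mono vec_norm2_mult_mat_vec_le) auto
  finally show "vec_norm2 ((M + N) *\<^sub>v x) \<le> (mat_norm2 M + mat_norm2 N) * vec_norm2 x"
    by (simp add: distrib_right)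
qed simp

lemma mat_norm2_contraction_mult_le:
  assumes M: "M \<in> carrier_mat m n" and N: "N \<in> carrier_mat n l" and contraction: "mat_norm2 M \<le> 1"
  shows "mat_norm2 (M * N) \<le> mat_norm2 N"
proof -
  have "mat_norm2 (M * N) \<le> mat_norm2 M * mat_norm2 N" using M N by (rule mat_norm2_mult_le)
  also have "\<dots> \<le> 1 * mat_norm2 N" using contraction by (intro mult_right_mono) auto
  finally show ?thesis by simp
qed

lemma mat_norm2_mult_contraction_le:
  assumes M: "M \<in> carrier_mat m n" and N: "N \<in> carrier_mat n l" and contraction: "mat_norm2 N \<le> 1"
  shows "mat_norm2 (M * N) \<le> mat_norm2 M"
proof -
  have "mat_norm2 (M * N) \<le> mat_norm2 M * mat_norm2 N" using M N by (rule mat_norm2_mult_le)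
  also have "\<dots> \<le> mat_norm2 M * 1" using contraction by (intro mult_left_mono) auto
  finally show ?thesis by simp
qed

text \<open>With \<open>z = M\<^sup>T y\<close> the square of the norm of \<open>z\<close> is the inner product of \<open>M z\<close> with \<open>y\<close>;
  Cauchy--Schwarz bounds it by a multiple of the norm of \<open>z\<close>, and one factor cancels.\<close>

lemma mat_norm2_transpose_le:
  assumes M: "M \<in> carrier_mat m n"
  shows "mat_norm2 (transpose_mat M) \<le> mat_norm2 M"
proof (rule mat_norm2_leI)
  show "transpose_mat M \<in> carrier_mat n m" using M by simp
next
  fix y :: "real vec" assume y: "y \<in> carrier_vec m"
  define z where "z = transpose_mat M *\<^sub>v y"
  have z: "z \<in> carrier_vec n" using M y by (simp add: z_def)
  have "vec_norm2 z * vec_norm2 z = (M *\<^sub>v z) \<bullet> y"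
    using scalar_prod_mult_mat_vec[OF M z y] by (simp add: vec_norm2_squared flip: z_def)
  also have "\<dots> \<le> vec_norm2 (M *\<^sub>v z) * vec_norm2 y"
    using M z y by (intro scalar_prod_le_vec_norm2[of _ m]) auto
  also have "\<dots> \<le> mat_norm2 M * vec_norm2 z * vec_norm2 y"
    using M z by (intro mult_right_mono vec_norm2_mult_mat_vec_le) auto
  finally have "vec_norm2 z * vec_norm2 z \<le> (mat_norm2 M * vec_norm2 y) * vec_norm2 z"
    by (simp add: mult_ac)
  then show "vec_norm2 (transpose_mat M *\<^sub>v y) \<le> mat_norm2 M * vec_norm2 y"
    unfolding z_def[symmetric]
    using vec_norm2_nonneg[of z] by (cases "vec_norm2 z = 0") auto
qed simp

lemma mat_norm2_orthonormal_le_1: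
  assumes M: "M \<in> carrier_mat m n" and orth: "transpose_mat M * M = 1\<^sub>m n"
  shows "mat_norm2 M \<le> 1"
proof (rule mat_norm2_leI[OF M])
  fix x :: "real vec" assume x: "x \<in> carrier_vec n"
  have "(M *\<^sub>v x) \<bullet> (M *\<^sub>v x) = x \<bullet> (transpose_mat M *\<^sub>v (M *\<^sub>v x))"
    using M x by (intro scalar_prod_mult_mat_vec) auto
  also have "transpose_mat M *\<^sub>v (M *\<^sub>v x) = x"
    using M x orth assoc_mult_mat_vec[of "transpose_mat M" n m M n x] by simp
  finally show "vec_norm2 (M *\<^sub>v x) \<le> 1 * vec_norm2 x" by (simp add: vec_norm2_def)
qed simp

text \<open>The hypothesis \<open>M\<^sup>T * M = M\<close> says in one equation that \<open>M\<close> is symmetric and idempotent,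
  that is, an orthogonal projection.\<close>

lemma mat_norm2_symmetric_idempotent_le_1:
  assumes M: "M \<in> carrier_mat n n" and proj: "transpose_mat M * M = M"
  shows "mat_norm2 M \<le> 1"
proof (rule mat_norm2_leI[OF M])
  fix x :: "real vec" assume x: "x \<in> carrier_vec n"
  have "vec_norm2 (M *\<^sub>v x) * vec_norm2 (M *\<^sub>v x) = x \<bullet> (transpose_mat M *\<^sub>v (M *\<^sub>v x))"
    unfolding vec_norm2_squared using M x by (intro scalar_prod_mult_mat_vec) auto
  also have "transpose_mat M *\<^sub>v (M *\<^sub>v x) = M *\<^sub>v x"
    using M x proj assoc_mult_mat_vec[of "transpose_mat M" n n M n x] by simp
  also have "x \<bullet> (M *\<^sub>v x) \<le> vec_norm2 x * vec_norm2 (M *\<^sub>v x)"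
    using M x by (intro scalar_prod_le_vec_norm2[of _ n]) auto
  finally show "vec_norm2 (M *\<^sub>v x) \<le> 1 * vec_norm2 x"
    using vec_norm2_nonneg[of "M *\<^sub>v x"]
    by (cases "vec_norm2 (M *\<^sub>v x) = 0") auto
qed simp

section \<open>Block matrices, columns and inverses\<close>

lemma mult_unit_vec_eq_col:
  fixes M :: "real mat"
  assumes "M \<in> carrier_mat m n" "j < n"
  shows "M *\<^sub>v unit_vec n j = col M j"
  using assms by (intro eq_vecI) auto

text \<open>Padding by zero rows is multiplication by \<open>pad m p\<close> from the left, the upper block is
  extracted by its transpose, and \<open>X * pad m p\<close> consists of the first \<open>m\<close> columns of \<open>X\<close>.
  Block operations thus become products with a matrix that has orthonormal columns.\<close>

definition pad :: "nat \<Rightarrow> nat \<Rightarrow> real mat" where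
  "pad m p = 1\<^sub>m m @\<^sub>r 0\<^sub>m p m"

lemma index_append_rows:
  assumes "X \<in> carrier_mat m n" "Y \<in> carrier_mat p n" "i < m + p" "j < n"
  shows "(X @\<^sub>r Y) $$ (i, j) = (if i < m then X $$ (i, j) else Y $$ (i - m, j))"
  using assms by (auto simp: append_rows_def)

lemma pad_carrier [simp]: "pad m p \<in> carrier_mat (m + p) m"
  by (simp add: pad_def)

lemma dim_pad [simp]: "dim_row (pad m p) = m + p" "dim_col (pad m p) = m"
  using pad_carrier[of m p] by blast+

lemma index_pad:
  assumes "i < m + p" "j < m"
  shows "pad m p $$ (i, j) = (if i = j then 1 else 0)"
  using assms unfolding pad_def by (subst index_append_rows[of _ m m _ p]) auto

lemma col_pad:
  assumes "j < m"
  shows "col (pad m p) j = unit_vec (m + p) j"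
  using assms by (intro eq_vecI) (auto simp: index_pad)

lemma index_mult_pad:
  assumes "X \<in> carrier_mat l (m + p)" "i < l" "j < m"
  shows "(X * pad m p) $$ (i, j) = X $$ (i, j)"
proof -
  have "(X * pad m p) $$ (i, j) = row X i \<bullet> col (pad m p) j"
    using assms by (intro index_mult_mat(1)) auto
  also have "\<dots> = X $$ (i, j)" using assms by (simp add: col_pad)
  finally show ?thesis .
qed

lemma transpose_pad_mult_append_rows:
  assumes X: "X \<in> carrier_mat m n" and Y: "Y \<in> carrier_mat p n"
  shows "transpose_mat (pad m p) * (X @\<^sub>r Y) = X"
proof (rule eq_matI)
  fix i j assume "i < dim_row X" "j < dim_col X"
  then have ij: "i < m" "j < n" using X by auto
  have XY: "X @\<^sub>r Y \<in> carrier_mat (m + p) n" using X Y by simp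
  have "(transpose_mat (pad m p) * (X @\<^sub>r Y)) $$ (i, j)
      = row (transpose_mat (pad m p)) i \<bullet> col (X @\<^sub>r Y) j"
    using ij XY by (intro index_mult_mat(1)) auto
  also have "\<dots> = (X @\<^sub>r Y) $$ (i, j)"
    using ij XY by (simp add: col_pad)
  also have "\<dots> = X $$ (i, j)"
    using ij by (simp add: index_append_rows[OF X Y])
  finally show "(transpose_mat (pad m p) * (X @\<^sub>r Y)) $$ (i, j) = X $$ (i, j)" .
qed (use X Y in \<open>auto simp: append_rows_def\<close>)

lemma pad_orthonormal: "transpose_mat (pad m p) * pad m p = 1\<^sub>m m"
  using transpose_pad_mult_append_rows[of "1\<^sub>m m" m m "0\<^sub>m p m" p] by (simp flip: pad_def)

lemma append_rows_zero_eq_pad_mult: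
  assumes X: "X \<in> carrier_mat m n"
  shows "X @\<^sub>r 0\<^sub>m p n = pad m p * X"
proof (rule eq_matI)
  fix i j assume "i < dim_row (pad m p * X)" "j < dim_col (pad m p * X)"
  then have ij: "i < m + p" "j < n" using X by auto
  have row: "row (pad m p) i = (if i < m then unit_vec m i else 0\<^sub>v m)"
    using ij by (intro eq_vecI) (auto simp: index_pad)
  have "(pad m p * X) $$ (i, j) = row (pad m p) i \<bullet> col X j"
    using ij X by (intro index_mult_mat(1)) auto
  also have "\<dots> = (if i < m then X $$ (i, j) else 0)"
    using ij X by (simp add: row)
  also have "\<dots> = (X @\<^sub>r 0\<^sub>m p n) $$ (i, j)"
    using ij X by (subst index_append_rows[of _ m n _ p]) auto
  finally show "(X @\<^sub>r 0\<^sub>m p n) $$ (i, j) = (pad m p * X) $$ (i, j)" by simp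
qed (use X in \<open>auto simp: append_rows_def\<close>)

lemma cols_upto_carrier [simp]: "cols_upto d x j \<in> carrier_mat d j"
  unfolding cols_upto_def using mat_of_cols_carrier(1)[of d "map x [1..<Suc j]"]
  by (simp del: upt_Suc)

lemma dim_cols_upto [simp]: "dim_row (cols_upto d x j) = d" "dim_col (cols_upto d x j) = j"
  using cols_upto_carrier[of d x j] by blast+

lemma col_cols_upto:
  assumes "l < j" "x (l + 1) \<in> carrier_vec d"
  shows "col (cols_upto d x j) l = x (l + 1)"
  using assms unfolding cols_upto_def
  by (subst col_mat_of_cols) (auto simp del: upt_Suc simp: nth_upt)

lemma cols_upto_mult_mat_vec:
  assumes M: "M \<in> carrier_mat d' d" and x: "\<And>i. i \<in> {1..j} \<Longrightarrow> x i \<in> carrier_vec d"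
  shows "cols_upto d' (\<lambda>i. M *\<^sub>v x i) j = M * cols_upto d x j"
proof (rule mat_col_eqI)
  fix l assume "l < dim_col (M * cols_upto d x j)"
  then have l: "l < j" by simp
  show "col (cols_upto d' (\<lambda>i. M *\<^sub>v x i) j) l = col (M * cols_upto d x j) l"
    using l x[of "l + 1"] M
    by (simp add: col_cols_upto col_mult2[OF M cols_upto_carrier l])
qed (use M in auto)

lemma outer_carrier [simp]:
  "x \<in> carrier_vec a \<Longrightarrow> y \<in> carrier_vec b \<Longrightarrow> outer x y \<in> carrier_mat a b"
  by (auto simp: outer_def)

lemma mult_outer:
  assumes M: "M \<in> carrier_mat c a" and x: "x \<in> carrier_vec a"
  shows "M * outer x y = outer (M *\<^sub>v x) y"
  using assms by (intro eq_matI) (auto simp: outer_def scalar_prod_def sum_distrib_right mult.assoc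
      intro!: sum.cong)

lemma last_unit_carrier [simp]: "last_unit j \<in> carrier_vec j"
  by (simp add: last_unit_def)

lemma lower_bidiag_carrier [simp]: "lower_bidiag \<alpha> \<beta> k \<in> carrier_mat (k + 1) k"
  by (simp add: lower_bidiag_def)

lemma dim_lower_bidiag [simp]:
  "dim_row (lower_bidiag \<alpha> \<beta> k) = k + 1" "dim_col (lower_bidiag \<alpha> \<beta> k) = k"
  by (simp_all add: lower_bidiag_def)

lemma upper_bidiag_carrier:
  assumes "1 \<le> k"
  shows "upper_bidiag \<alpha> \<beta> k \<in> carrier_mat k k"
proof -
  have "upper_bidiag \<alpha> \<beta> k \<in> carrier_mat ((k - 1) + 1) k"
    unfolding upper_bidiag_def using assms lower_bidiag_carrier[of \<alpha> \<beta> "k - 1"]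
    by (intro carrier_append_rows) (auto simp: mat_of_rows_def)
  then show ?thesis using assms by simp
qed

lemma index_upper_bidiag:
  assumes "i < k" "j < k"
  shows "upper_bidiag \<alpha> \<beta> k $$ (i, j) = lower_bidiag \<alpha> \<beta> k $$ (j, i)"
proof -
  have c: "transpose_mat (lower_bidiag \<alpha> \<beta> (k - 1)) \<in> carrier_mat (k - 1) k"
    using assms lower_bidiag_carrier[of \<alpha> \<beta> "k - 1"] by simp
  have "upper_bidiag \<alpha> \<beta> k $$ (i, j) =
      (if i < k - 1 then transpose_mat (lower_bidiag \<alpha> \<beta> (k - 1)) $$ (i, j)
       else mat_of_rows k [\<alpha> k \<cdot>\<^sub>v last_unit k] $$ (i - (k - 1), j))"
    unfolding upper_bidiag_def using assms
    by (intro index_append_rows[OF c, of _ 1]) (auto simp: mat_of_rows_def)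
  also have "\<dots> = lower_bidiag \<alpha> \<beta> k $$ (j, i)"
    using assms by (auto simp: lower_bidiag_def mat_of_rows_def last_unit_def)
  finally show ?thesis .
qed

lemma transpose_lower_bidiag_mult_pad:
  assumes "1 \<le> k"
  shows "transpose_mat (lower_bidiag \<alpha> \<beta> k) * pad k 1 = upper_bidiag \<alpha> \<beta> k"
proof (rule eq_matI)
  fix i j assume "i < dim_row (upper_bidiag \<alpha> \<beta> k)" "j < dim_col (upper_bidiag \<alpha> \<beta> k)"
  then have ij: "i < k" "j < k" using upper_bidiag_carrier[OF assms, of \<alpha> \<beta>] by auto
  then show "(transpose_mat (lower_bidiag \<alpha> \<beta> k) * pad k 1) $$ (i, j) = upper_bidiag \<alpha> \<beta> k $$ (i, j)"
    using lower_bidiag_carrier[of \<alpha> \<beta> k]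
    by (subst index_mult_pad[of _ k]) (auto simp: index_upper_bidiag)
qed (use upper_bidiag_carrier[OF assms, of \<alpha> \<beta>] in auto)

lemma outer_last_unit_mult_pad:
  assumes x: "x \<in> carrier_vec d"
  shows "outer x (last_unit (k + 1)) * pad k 1 = 0\<^sub>m d k"
proof (rule eq_matI)
  fix i j assume "i < dim_row (0\<^sub>m d k)" "j < dim_col (0\<^sub>m d k)"
  then show "(outer x (last_unit (k + 1)) * pad k 1) $$ (i, j) = 0\<^sub>m d k $$ (i, j)"
    using x by (subst index_mult_pad[of _ d]) (auto simp: outer_def last_unit_def)
qed (use x in \<open>auto simp: outer_def\<close>)

lemma mat_inv_inverse:
  assumes M: "M \<in> carrier_mat n n" and inv: "invertible_mat M"
  shows "mat_inv M \<in> carrier_mat n n" "M * mat_inv M = 1\<^sub>m n" "mat_inv M * M = 1\<^sub>m n"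
proof -
  obtain N where N: "M * N = 1\<^sub>m n" "N * M = 1\<^sub>m (dim_row N)"
    using inv M by (auto simp: invertible_mat_def inverts_mat_def)
  have "dim_col N = n" using arg_cong[OF N(1), of dim_col] by simp
  moreover have "dim_row N = n" using arg_cong[OF N(2), of dim_col] M by simp
  ultimately have "M \<in> Units (ring_mat TYPE(real) n ())"
    using M N by (auto simp: Units_def ring_mat_def intro!: bexI[of _ N])
  then obtain M' where "mat_inverse M = Some M'"
    using mat_inverse(1)[OF M, of "()"] by auto
  with mat_inverse(2)[OF M] show "mat_inv M \<in> carrier_mat n n"
    "M * mat_inv M = 1\<^sub>m n" "mat_inv M * M = 1\<^sub>m n"
    by (auto simp: mat_inv_def)
qed

section \<open>The orthogonal projection onto the column space of an orthonormal matrix\<close>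

lemma transpose_mult_projection:
  fixes Q :: "real mat"
  assumes Q: "Q \<in> carrier_mat N n" and orth: "transpose_mat Q * Q = 1\<^sub>m n"
  shows "transpose_mat Q * (Q * transpose_mat Q) = transpose_mat Q"
  using Q orth assoc_mult_mat[of "transpose_mat Q" n N Q n "transpose_mat Q" N] by simp

lemma projection_idempotent:
  fixes Q :: "real mat"
  assumes Q: "Q \<in> carrier_mat N n" and orth: "transpose_mat Q * Q = 1\<^sub>m n"
  shows "Q * transpose_mat Q * (Q * transpose_mat Q) = Q * transpose_mat Q"
  using Q transpose_mult_projection[OF assms]
  by (simp add: assoc_mult_mat[of Q N n "transpose_mat Q" N "Q * transpose_mat Q" N])

lemma projection_symmetric:
  fixes Q :: "real mat"
  assumes Q: "Q \<in> carrier_mat N n"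
  shows "transpose_mat (Q * transpose_mat Q) = Q * transpose_mat Q"
  using Q by (simp add: transpose_mult[of Q N n])

lemma mat_norm2_projection_le_1:
  assumes Q: "Q \<in> carrier_mat N n" and orth: "transpose_mat Q * Q = 1\<^sub>m n"
  shows "mat_norm2 (Q * transpose_mat Q) \<le> 1"
proof (rule mat_norm2_symmetric_idempotent_le_1)
  show "Q * transpose_mat Q \<in> carrier_mat N N" using Q by simp
qed (simp only: projection_symmetric[OF Q] projection_idempotent[OF assms])

lemma mat_norm2_complementary_projection_le_1:
  assumes Q: "Q \<in> carrier_mat N n" and orth: "transpose_mat Q * Q = 1\<^sub>m n"
  shows "mat_norm2 (1\<^sub>m N - Q * transpose_mat Q) \<le> 1"
proof (rule mat_norm2_symmetric_idempotent_le_1)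
  define H where "H = Q * transpose_mat Q"
  have H: "H \<in> carrier_mat N N" using Q by (simp add: H_def)
  have HH: "H * H = H" "transpose_mat H = H"
    unfolding H_def by (rule projection_idempotent[OF assms], rule projection_symmetric[OF Q])
  have P: "1\<^sub>m N - H \<in> carrier_mat N N" using H by (rule minus_carrier_mat)
  then show "1\<^sub>m N - Q * transpose_mat Q \<in> carrier_mat N N" by (simp only: H_def)
  have "transpose_mat (1\<^sub>m N - H) = 1\<^sub>m N - H"
    using H HH by (simp add: transpose_minus[of _ N N])
  moreover have "(1\<^sub>m N - H) * (1\<^sub>m N - H) = 1\<^sub>m N - H"
  proof -
    have "(1\<^sub>m N - H) * (1\<^sub>m N - H) = (1\<^sub>m N - H) - H * (1\<^sub>m N - H)"
      using minus_mult_distrib_mat[OF one_carrier_mat H P] left_mult_one_mat[OF P] by simp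
    also have "H * (1\<^sub>m N - H) = H - H"
      using mult_minus_distrib_mat[OF H one_carrier_mat H] H HH by simp
    also have "(1\<^sub>m N - H) - (H - H) = 1\<^sub>m N - H" using H by (intro eq_matI) auto
    finally show ?thesis .
  qed
  ultimately show "transpose_mat (1\<^sub>m N - Q * transpose_mat Q) * (1\<^sub>m N - Q * transpose_mat Q)
      = 1\<^sub>m N - Q * transpose_mat Q"
    by (simp add: H_def)
qed

text \<open>The product \<open>Q * Q\<^sup>T * W\<close> lies in the range of the projection. Hence the part of \<open>V * T\<close>
  orthogonal to that range is minus that of \<open>G\<close>, and multiplying by the inverse of \<open>T\<close> turns this
  into a formula for how far \<open>V\<close> is from being fixed by the projection.\<close>

lemma projection_mult_eq:
  fixes Q W V T T' G :: "real mat"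
  assumes Q: "Q \<in> carrier_mat N n" and orth: "transpose_mat Q * Q = 1\<^sub>m n"
    and W: "W \<in> carrier_mat N k" and V: "V \<in> carrier_mat N k" and G: "G \<in> carrier_mat N k"
    and T: "T \<in> carrier_mat k k" and T': "T' \<in> carrier_mat k k" and inv: "T * T' = 1\<^sub>m k"
    and rec: "Q * transpose_mat Q * W = V * T + G"
  shows "Q * transpose_mat Q * V = V + (1\<^sub>m N - Q * transpose_mat Q) * (G * T')"
proof -
  define H where "H = Q * transpose_mat Q"
  have H: "H \<in> carrier_mat N N" using Q by (simp add: H_def)
  have HH: "H * H = H" unfolding H_def by (rule projection_idempotent[OF Q orth])
  have GT: "G * T' \<in> carrier_mat N k" using G T' by (rule mult_carrier_mat)
  have "V = V * T * T'"
    using V T T' inv by (simp add: assoc_mult_mat[of V N k T k T' k])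
  then have split: "H * W * T' = V + G * T'"
    using rec V T T' G by (simp add: H_def[symmetric] add_mult_distrib_mat[of _ N k])
  have "H * (H * W * T') = H * W * T'"
    using assoc_mult_mat[OF H mult_carrier_mat[OF H W] T'] assoc_mult_mat[OF H H W] HH by simp
  then have eq: "H * V + H * (G * T') = V + G * T'"
    unfolding split by (simp only: mult_add_distrib_mat[OF H V GT])
  have "H * V = V + (G * T' - H * (G * T'))"
  proof (rule eq_matI)
    fix i j assume "i < dim_row (V + (G * T' - H * (G * T')))" "j < dim_col (V + (G * T' - H * (G * T')))"
    then have ij: "i < N" "j < k" using H GT by auto
    have HV: "H * V \<in> carrier_mat N k" and HG: "H * (G * T') \<in> carrier_mat N k"
      using H V GT by (auto intro: mult_carrier_mat)
    have "(H * V + H * (G * T')) $$ (i, j) = (V + G * T') $$ (i, j)" by (simp only: eq)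
    then have "(H * V) $$ (i, j) + (H * (G * T')) $$ (i, j) = V $$ (i, j) + (G * T') $$ (i, j)"
      using ij V GT HV HG by (simp only: index_add_mat(1) carrier_matD)
    then show "(H * V) $$ (i, j) = (V + (G * T' - H * (G * T'))) $$ (i, j)"
      using ij V GT HV HG
      by (simp only: index_add_mat index_minus_mat carrier_matD)
  qed (use H V GT in auto)
  also have "G * T' - H * (G * T') = (1\<^sub>m N - H) * (G * T')"
    using minus_mult_distrib_mat[OF one_carrier_mat H GT] left_mult_one_mat[OF GT] by simp
  finally show ?thesis by (simp only: H_def)
qed

section \<open>Transfer of the recurrences to the projected vectors\<close>

context jbd_finite_precision
begin

abbreviation "Q \<equiv> QA @\<^sub>r QL"
abbreviation "U \<equiv> cols_upto m u (k + 1)"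
abbreviation "Vt \<equiv> cols_upto (m + p) vt k"
abbreviation "B \<equiv> lower_bidiag \<alpha> \<beta> k"
abbreviation "T \<equiv> upper_bidiag \<alpha> \<beta> k"

lemma Q_carrier: "Q \<in> carrier_mat (m + p) n"
  using QA_carrier QL_carrier by simp

lemma V_eq: "cols_upto n (\<lambda>i. transpose_mat Q *\<^sub>v vt i) k = transpose_mat Q * Vt"
  using Q_carrier vt_carrier by (intro cols_upto_mult_mat_vec) auto

lemma recurrence_QA_transpose:
  "transpose_mat QA * U = transpose_mat Q * Vt * transpose_mat B
     + \<alpha> (k + 1) \<cdot>\<^sub>m outer (transpose_mat Q *\<^sub>v vt (k + 1)) (last_unit (k + 1))
     + transpose_mat Q * Gt"
proof -
  let ?S = "pad m p" and ?O = "outer (vt (k + 1)) (last_unit (k + 1))"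
  note Qc = Q_carrier
  note Tc = Qc[THEN transpose_carrier_mat[THEN iffD2]]
  have vt: "vt (k + 1) \<in> carrier_vec (m + p)" by (intro vt_carrier) auto
  have O: "?O \<in> carrier_mat (m + p) (k + 1)" using vt by simp
  have Bc: "transpose_mat B \<in> carrier_mat k (k + 1)" by auto
  have VB: "Vt * transpose_mat B \<in> carrier_mat (m + p) (k + 1)"
    by (rule mult_carrier_mat[OF cols_upto_carrier Bc])
  have "transpose_mat Q * (Q * transpose_mat Q * (?S * U)) = transpose_mat Q * (?S * U)"
    using assoc_mult_mat[OF Tc mult_carrier_mat[OF Qc Tc] mult_carrier_mat[OF pad_carrier cols_upto_carrier]]
    by (simp only: transpose_mult_projection[OF Qc orthonormal])
  also have "\<dots> = transpose_mat Q * ?S * U"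
    using assoc_mult_mat[OF Tc pad_carrier cols_upto_carrier] by simp
  also have "transpose_mat Q * ?S = transpose_mat QA"
    using transpose_mult[OF transpose_carrier_mat[THEN iffD2, OF pad_carrier] Qc]
    by (simp add: transpose_pad_mult_append_rows[OF QA_carrier QL_carrier])
  finally have "transpose_mat QA * U = transpose_mat Q * (Q * transpose_mat Q * (U @\<^sub>r 0\<^sub>m p (k + 1)))"
    by (simp add: append_rows_zero_eq_pad_mult[OF cols_upto_carrier])
  also have "\<dots> = transpose_mat Q * (Vt * transpose_mat B + \<alpha> (k + 1) \<cdot>\<^sub>m ?O + Gt)"
    by (simp only: recurrence_vt)
  also have "\<dots> = transpose_mat Q * (Vt * transpose_mat B) + transpose_mat Q * (\<alpha> (k + 1) \<cdot>\<^sub>m ?O)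
      + transpose_mat Q * Gt"
    by (simp only: mult_add_distrib_mat[OF Tc add_carrier_mat[OF smult_carrier_mat[OF O]] Gt_carrier]
        mult_add_distrib_mat[OF Tc VB smult_carrier_mat[OF O]])
  also have "transpose_mat Q * (Vt * transpose_mat B) = transpose_mat Q * Vt * transpose_mat B"
    using assoc_mult_mat[OF Tc cols_upto_carrier Bc] by simp
  also have "transpose_mat Q * (\<alpha> (k + 1) \<cdot>\<^sub>m ?O)
      = \<alpha> (k + 1) \<cdot>\<^sub>m outer (transpose_mat Q *\<^sub>v vt (k + 1)) (last_unit (k + 1))"
    by (simp only: mult_smult_distrib[OF Tc O] mult_outer[OF Tc vt])
  finally show ?thesis .
qed

lemma mat_norm2_residual_vt_le: "mat_norm2 (transpose_mat Q * Gt) \<le> C * \<epsilon>"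
proof -
  have "mat_norm2 (transpose_mat Q) \<le> 1"
    using mat_norm2_transpose_le[OF Q_carrier] mat_norm2_orthonormal_le_1[OF Q_carrier orthonormal]
    by (rule order_trans)
  then have "mat_norm2 (transpose_mat Q * Gt) \<le> mat_norm2 Gt"
    using Q_carrier Gt_carrier by (intro mat_norm2_contraction_mult_le[of _ n "m + p"]) auto
  then show ?thesis using Gt_bound by (rule order_trans)
qed

text \<open>The rank-one term of the recurrence lives in column \<open>k + 1\<close> only, and the transpose of the
  lower bidiagonal matrix starts with the square upper bidiagonal one. Restricting to the first
  \<open>k\<close> columns therefore leaves an invertible coefficient matrix.\<close>

lemma recurrence_vt_first_columns:
  assumes k: "1 \<le> k"
  shows "Q * transpose_mat Q * (pad m p * (U * pad k 1)) = Vt * T + Gt * pad k 1"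
proof -
  let ?E = "pad k 1" and ?O = "outer (vt (k + 1)) (last_unit (k + 1))"
  have vt: "vt (k + 1) \<in> carrier_vec (m + p)" by (intro vt_carrier) auto
  have O: "?O \<in> carrier_mat (m + p) (k + 1)" using vt by simp
  have H: "Q * transpose_mat Q \<in> carrier_mat (m + p) (m + p)" using Q_carrier by simp
  have Bc: "transpose_mat B \<in> carrier_mat k (k + 1)" by auto
  have "Q * transpose_mat Q * (pad m p * (U * ?E)) = Q * transpose_mat Q * (pad m p * U) * ?E"
    by (simp only: assoc_mult_mat[OF H mult_carrier_mat[OF pad_carrier cols_upto_carrier] pad_carrier]
        assoc_mult_mat[OF pad_carrier cols_upto_carrier pad_carrier])
  also have "\<dots> = (Vt * transpose_mat B + \<alpha> (k + 1) \<cdot>\<^sub>m ?O + Gt) * ?E"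
    by (simp only: recurrence_vt append_rows_zero_eq_pad_mult[OF cols_upto_carrier, symmetric])
  also have "\<dots> = Vt * transpose_mat B * ?E + (\<alpha> (k + 1) \<cdot>\<^sub>m ?O) * ?E + Gt * ?E"
    by (simp only: add_mult_distrib_mat[OF add_carrier_mat[OF smult_carrier_mat[OF O]] Gt_carrier pad_carrier]
        add_mult_distrib_mat[OF mult_carrier_mat[OF cols_upto_carrier Bc] smult_carrier_mat[OF O] pad_carrier])
  also have "(\<alpha> (k + 1) \<cdot>\<^sub>m ?O) * ?E = 0\<^sub>m (m + p) k"
    using mult_smult_assoc_mat[OF O pad_carrier] outer_last_unit_mult_pad[OF vt] by simp
  also have "Vt * transpose_mat B * ?E = Vt * T"
    by (simp only: assoc_mult_mat[OF cols_upto_carrier Bc pad_carrier] transpose_lower_bidiag_mult_pad[OF k])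
  also have "Vt * T + 0\<^sub>m (m + p) k = Vt * T"
    using mult_carrier_mat[OF cols_upto_carrier upper_bidiag_carrier[OF k]] by simp
  finally show ?thesis .
qed

lemma mat_norm2_residual_first_columns_le: "mat_norm2 (Gt * pad k 1) \<le> C * \<epsilon>"
  using mat_norm2_mult_contraction_le[OF Gt_carrier pad_carrier
      mat_norm2_orthonormal_le_1[OF pad_carrier pad_orthonormal]] Gt_bound
  by (rule order_trans)

text \<open>The residual combines that of the computed recurrence with the upper block of the drift of
  the computed vectors out of the column space of \<open>Q\<close>.\<close>

lemma residual_u:
  assumes k: "1 \<le> k"
  defines "F \<equiv> Ft + transpose_mat (pad m p) *
      ((1\<^sub>m (m + p) - Q * transpose_mat Q) * (Gt * pad k 1 * mat_inv T))"
  shows "QA * (transpose_mat Q * Vt) = U * B + F"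
    and "F \<in> carrier_mat m k"
    and "mat_norm2 F \<le> C * \<epsilon> + C * \<epsilon> * mat_norm2 (mat_inv T)"
proof -
  let ?S = "pad m p" and ?E = "pad k 1" and ?P = "1\<^sub>m (m + p) - Q * transpose_mat Q"
  note Qc = Q_carrier
  note inv = mat_inv_inverse[OF upper_bidiag_carrier[OF k] B_invertible]
  have Sc: "transpose_mat ?S \<in> carrier_mat m (m + p)" by simp
  have Tc: "transpose_mat Q \<in> carrier_mat n (m + p)" using Qc by simp
  have Pc: "?P \<in> carrier_mat (m + p) (m + p)"
    using Qc by (intro minus_carrier_mat mult_carrier_mat[of _ _ n]) auto
  have GE: "Gt * ?E \<in> carrier_mat (m + p) k" using Gt_carrier pad_carrier by (rule mult_carrier_mat)
  have GEi: "Gt * ?E * mat_inv T \<in> carrier_mat (m + p) k" using GE inv(1) by (rule mult_carrier_mat)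
  have PG: "?P * (Gt * ?E * mat_inv T) \<in> carrier_mat (m + p) k"
    using Pc GEi by (rule mult_carrier_mat)
  have SPG: "transpose_mat ?S * (?P * (Gt * ?E * mat_inv T)) \<in> carrier_mat m k"
    using Sc PG by (rule mult_carrier_mat)
  have UB: "U * B \<in> carrier_mat m k" by (rule mult_carrier_mat) auto
  show F: "F \<in> carrier_mat m k"
    unfolding F_def using Ft_carrier SPG by simp
  have "QA * (transpose_mat Q * Vt) = transpose_mat ?S * Q * (transpose_mat Q * Vt)"
    by (simp only: transpose_pad_mult_append_rows[OF QA_carrier QL_carrier])
  also have "\<dots> = transpose_mat ?S * (Q * transpose_mat Q * Vt)"
    using assoc_mult_mat[OF Sc Qc mult_carrier_mat[OF Tc cols_upto_carrier]]
      assoc_mult_mat[OF Qc Tc cols_upto_carrier] by simp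
  also have "Q * transpose_mat Q * Vt = Vt + ?P * (Gt * ?E * mat_inv T)"
    by (intro projection_mult_eq[OF Qc orthonormal _ _ GE upper_bidiag_carrier[OF k] inv(1) inv(2)
          recurrence_vt_first_columns[OF k]] mult_carrier_mat[OF pad_carrier]
        mult_carrier_mat[OF cols_upto_carrier pad_carrier]) auto
  also have "transpose_mat ?S * (Vt + ?P * (Gt * ?E * mat_inv T))
      = U * B + Ft + transpose_mat ?S * (?P * (Gt * ?E * mat_inv T))"
    using recurrence_u mult_add_distrib_mat[OF Sc cols_upto_carrier PG] by (simp add: pad_def)
  also have "\<dots> = U * B + F"
    unfolding F_def using assoc_add_mat[OF UB Ft_carrier SPG] by simp
  finally show "QA * (transpose_mat Q * Vt) = U * B + F" .
  have S1: "mat_norm2 (transpose_mat ?S) \<le> 1"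
    using mat_norm2_transpose_le[OF pad_carrier] mat_norm2_orthonormal_le_1[OF pad_carrier pad_orthonormal]
    by (rule order_trans)
  have "mat_norm2 (transpose_mat ?S * (?P * (Gt * ?E * mat_inv T)))
      \<le> mat_norm2 (?P * (Gt * ?E * mat_inv T))"
    using Sc PG S1 by (rule mat_norm2_contraction_mult_le)
  also have "\<dots> \<le> mat_norm2 (Gt * ?E * mat_inv T)"
    using Pc GEi mat_norm2_complementary_projection_le_1[OF Qc orthonormal]
    by (rule mat_norm2_contraction_mult_le)
  also have "\<dots> \<le> mat_norm2 (Gt * ?E) * mat_norm2 (mat_inv T)"
    using GE inv(1) by (rule mat_norm2_mult_le)
  also have "\<dots> \<le> C * \<epsilon> * mat_norm2 (mat_inv T)"
    using mat_norm2_residual_first_columns_le by (intro mult_right_mono) auto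
  finally show "mat_norm2 F \<le> C * \<epsilon> + C * \<epsilon> * mat_norm2 (mat_inv T)"
    unfolding F_def using mat_norm2_add_le[OF Ft_carrier SPG] Ft_bound by linarith
qed

lemma upper_bidiag_mult_unit_vec_0:
  assumes k: "1 \<le> k"
  shows "T *\<^sub>v unit_vec k 0 = \<alpha> 1 \<cdot>\<^sub>v unit_vec k 0"
proof -
  have "T *\<^sub>v unit_vec k 0 = col T 0"
    using k upper_bidiag_carrier[OF k, of \<alpha> \<beta>] by (intro mult_unit_vec_eq_col) auto
  also have "\<dots> = \<alpha> 1 \<cdot>\<^sub>v unit_vec k 0"
    using k upper_bidiag_carrier[OF k, of \<alpha> \<beta>]
    by (intro eq_vecI) (auto simp: index_upper_bidiag lower_bidiag_def unit_vec_def)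
  finally show ?thesis .
qed

text \<open>The first column of the recurrence for \<open>vt\<close> expresses \<open>\<alpha> 1 \<cdot>\<^sub>v vt 1\<close> as the projection of a
  padded unit vector, up to the first column of \<open>Gt\<close>.\<close>

lemma abs_alpha_1_le:
  assumes k: "1 \<le> k"
  shows "\<bar>\<alpha> 1\<bar> \<le> 1 + C * \<epsilon>"
proof -
  let ?S = "pad m p" and ?E = "pad k 1" and ?e = "unit_vec k 0" and ?H = "Q * transpose_mat Q"
  have vt1: "vt 1 \<in> carrier_vec (m + p)" "vec_norm2 (vt 1) = 1"
    using vt_carrier[of 1] vt_unit[of 1] by auto
  have u1: "u 1 \<in> carrier_vec m" "vec_norm2 (u 1) = 1"
    using u_carrier[of 1] u_unit[of 1] by auto
  have H: "?H \<in> carrier_mat (m + p) (m + p)" using Q_carrier by simp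
  have GE: "Gt * ?E \<in> carrier_mat (m + p) k" using Gt_carrier pad_carrier by (rule mult_carrier_mat)
  have VT: "Vt * T \<in> carrier_mat (m + p) k"
    using cols_upto_carrier upper_bidiag_carrier[OF k] by (rule mult_carrier_mat)
  have UE: "U * ?E \<in> carrier_mat m k" using cols_upto_carrier pad_carrier by (rule mult_carrier_mat)
  have "U * ?E *\<^sub>v ?e = U *\<^sub>v col ?E 0"
    using k
    by (simp only: assoc_mult_mat_vec[OF cols_upto_carrier pad_carrier unit_vec_carrier]
        mult_unit_vec_eq_col[OF pad_carrier, of 0 k 1])
  also have "\<dots> = u 1"
    using k u1 mult_unit_vec_eq_col[OF cols_upto_carrier, of 0 "k + 1" m u]
    by (simp add: col_pad col_cols_upto)
  finally have UEe: "U * ?E *\<^sub>v ?e = u 1" .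
  have "Vt * T *\<^sub>v ?e = Vt *\<^sub>v (\<alpha> 1 \<cdot>\<^sub>v ?e)"
    using assoc_mult_mat_vec[OF cols_upto_carrier upper_bidiag_carrier[OF k] unit_vec_carrier]
    by (simp only: upper_bidiag_mult_unit_vec_0[OF k])
  also have "\<dots> = \<alpha> 1 \<cdot>\<^sub>v vt 1"
    using k vt1 mult_mat_vec[OF cols_upto_carrier unit_vec_carrier, of "m + p" vt k "\<alpha> 1" 0]
      mult_unit_vec_eq_col[OF cols_upto_carrier, of 0 k "m + p" vt]
    by (simp add: col_cols_upto)
  finally have VTe: "Vt * T *\<^sub>v ?e = \<alpha> 1 \<cdot>\<^sub>v vt 1" .
  have "?H *\<^sub>v (?S *\<^sub>v u 1) = ?H * (?S * (U * ?E)) *\<^sub>v ?e"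
    using assoc_mult_mat_vec[OF H mult_carrier_mat[OF pad_carrier UE] unit_vec_carrier]
      assoc_mult_mat_vec[OF pad_carrier UE unit_vec_carrier]
    by (simp only: UEe)
  also have "\<dots> = \<alpha> 1 \<cdot>\<^sub>v vt 1 + (Gt * ?E) *\<^sub>v ?e"
    using add_mult_distrib_mat_vec[OF VT GE unit_vec_carrier]
    by (simp only: recurrence_vt_first_columns[OF k] VTe)
  finally have eq: "?H *\<^sub>v (?S *\<^sub>v u 1) = \<alpha> 1 \<cdot>\<^sub>v vt 1 + (Gt * ?E) *\<^sub>v ?e" .
  have g: "(Gt * ?E) *\<^sub>v ?e \<in> carrier_vec (m + p)"
    using GE unit_vec_carrier by (rule mult_mat_vec_carrier)
  have z: "?H *\<^sub>v (?S *\<^sub>v u 1) \<in> carrier_vec (m + p)"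
    using H mult_mat_vec_carrier[OF pad_carrier u1(1)] by (rule mult_mat_vec_carrier)
  have "\<alpha> 1 \<cdot>\<^sub>v vt 1 = ?H *\<^sub>v (?S *\<^sub>v u 1) + - ((Gt * ?E) *\<^sub>v ?e)"
    unfolding eq using vt1 g by (intro eq_vecI) auto
  then have "\<bar>\<alpha> 1\<bar> \<le> vec_norm2 (?H *\<^sub>v (?S *\<^sub>v u 1)) + vec_norm2 ((Gt * ?E) *\<^sub>v ?e)"
    using vec_norm2_add_le[OF z, of "- ((Gt * ?E) *\<^sub>v ?e)"] g vt1
    by (metis mult.right_neutral uminus_carrier_vec vec_norm2_smult vec_norm2_uminus)
  moreover have "vec_norm2 (?H *\<^sub>v (?S *\<^sub>v u 1)) \<le> vec_norm2 (?S *\<^sub>v u 1)"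
    using mult_mat_vec_carrier[OF pad_carrier u1(1)]
    by (intro vec_norm2_contraction_le[OF H] mat_norm2_projection_le_1[OF Q_carrier orthonormal])
  moreover have "vec_norm2 (?S *\<^sub>v u 1) \<le> vec_norm2 (u 1)"
    by (intro vec_norm2_contraction_le[OF pad_carrier u1(1)]
        mat_norm2_orthonormal_le_1[OF pad_carrier pad_orthonormal])
  moreover have "vec_norm2 ((Gt * ?E) *\<^sub>v ?e) \<le> C * \<epsilon>"
    using vec_norm2_mult_mat_vec_le[OF GE unit_vec_carrier, of 0] k
      mat_norm2_residual_first_columns_le by (simp add: vec_norm2_unit_vec)
  ultimately show ?thesis using u1(2) by linarith
qed

lemma one_le_mat_norm2_inverse:
  assumes k: "1 \<le> k"
  shows "1 \<le> (1 + C * \<epsilon>) * mat_norm2 (mat_inv T)"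
proof -
  let ?e = "unit_vec k 0"
  note inv = mat_inv_inverse[OF upper_bidiag_carrier[OF k] B_invertible]
  have "?e = mat_inv T * T *\<^sub>v ?e" by (simp add: inv(3))
  also have "\<dots> = mat_inv T *\<^sub>v (\<alpha> 1 \<cdot>\<^sub>v ?e)"
    using assoc_mult_mat_vec[OF inv(1) upper_bidiag_carrier[OF k] unit_vec_carrier]
    by (simp only: upper_bidiag_mult_unit_vec_0[OF k])
  also have "\<dots> = \<alpha> 1 \<cdot>\<^sub>v (mat_inv T *\<^sub>v ?e)"
    using inv(1) unit_vec_carrier by (rule mult_mat_vec)
  finally have "vec_norm2 ?e = \<bar>\<alpha> 1\<bar> * vec_norm2 (mat_inv T *\<^sub>v ?e)"
    using vec_norm2_smult by metis
  also have "\<dots> \<le> (1 + C * \<epsilon>) * (mat_norm2 (mat_inv T) * vec_norm2 ?e)"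
    using abs_alpha_1_le[OF k] vec_norm2_mult_mat_vec_le[OF inv(1) unit_vec_carrier]
    by (intro mult_mono) auto
  finally show ?thesis using k by (simp add: vec_norm2_unit_vec)
qed

lemma C_nonneg:
  assumes "0 < \<epsilon>"
  shows "0 \<le> C"
proof -
  have "0 \<le> C * \<epsilon>" using mat_norm2_nonneg Gt_bound by (rule order_trans)
  then show ?thesis using assms by (simp add: zero_le_mult_iff)
qed

text \<open>The lower bound on \<open>mat_norm2 (mat_inv T)\<close> lets the contribution of \<open>Ft\<close>, which does not
  carry that factor, be absorbed into the contribution that does.\<close>

lemma residual_bound_absorb:
  assumes k: "1 \<le> k" and \<epsilon>: "0 < \<epsilon>" "\<epsilon> \<le> 1"
  shows "C * \<epsilon> + C * \<epsilon> * mat_norm2 (mat_inv T) \<le> C * (2 + C) * (mat_norm2 (mat_inv T) * \<epsilon>)"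
proof -
  have C: "0 \<le> C" using \<epsilon>(1) by (rule C_nonneg)
  have "1 \<le> (1 + C * \<epsilon>) * mat_norm2 (mat_inv T)" by (rule one_le_mat_norm2_inverse[OF k])
  also have "\<dots> \<le> (1 + C) * mat_norm2 (mat_inv T)"
    using C \<epsilon> by (intro mult_right_mono add_left_mono) (auto simp: mult_left_le)
  finally have "C * \<epsilon> * 1 \<le> C * \<epsilon> * ((1 + C) * mat_norm2 (mat_inv T))"
    using C \<epsilon> by (intro mult_left_mono) auto
  then show ?thesis by (simp add: algebra_simps)
qed

end

theorem theorem3p1:
  fixes k :: nat and c1 C :: real
  assumes "1 \<le> k"
  shows "\<exists>K \<epsilon>0. 0 < K \<and> 0 < \<epsilon>0 \<and>
    (\<forall>\<epsilon> m n p A L QA QL R u vt \<alpha> \<beta> Ft Gt.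
      0 < \<epsilon> \<and> \<epsilon> \<le> \<epsilon>0 \<and>
      jbd_finite_precision m n p A L QA QL R k c1 C \<epsilon> u vt \<alpha> \<beta> Ft Gt \<longrightarrow>
      (let Q = QA @\<^sub>r QL;
           v = (\<lambda>i. transpose_mat Q *\<^sub>v vt i);
           U = cols_upto m u (k + 1);
           V = cols_upto n v k;
           B = lower_bidiag \<alpha> \<beta> k;
           G = transpose_mat Q * Gt
       in \<exists>F \<in> carrier_mat m k.
            QA * V = U * B + F \<and>
            transpose_mat QA * U
              = V * transpose_mat B + \<alpha> (k + 1) \<cdot>\<^sub>m outer (v (k + 1)) (last_unit (k + 1)) + G \<and>
            mat_norm2 F \<le> K * (mat_norm2 (mat_inv (upper_bidiag \<alpha> \<beta> k)) * \<epsilon>) \<and>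
            mat_norm2 G \<le> K * \<epsilon>))"
proof -
  \<comment> \<open>The constant is chosen before an instance of the model supplies \<open>0 \<le> C\<close>, hence the absolute
    values; the final \<open>1\<close> makes it positive also for \<open>C = 0\<close>.\<close>
  let ?K = "\<bar>C\<bar> * (2 + \<bar>C\<bar>) + \<bar>C\<bar> + 1"
  show ?thesis
  proof (rule exI[of _ ?K], rule exI[of _ 1], intro conjI allI impI)
    show "0 < ?K" by (simp add: add_nonneg_pos)
    fix \<epsilon> m n p A L QA QL R u vt \<alpha> \<beta> Ft Gt
    assume "0 < \<epsilon> \<and> \<epsilon> \<le> 1 \<and> jbd_finite_precision m n p A L QA QL R k c1 C \<epsilon> u vt \<alpha> \<beta> Ft Gt"
    then have \<epsilon>: "0 < \<epsilon>" "\<epsilon> \<le> 1"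
      and "jbd_finite_precision m n p A L QA QL R k c1 C \<epsilon> u vt \<alpha> \<beta> Ft Gt"
      by auto
    then interpret jbd_finite_precision m n p A L QA QL R k c1 C \<epsilon> u vt \<alpha> \<beta> Ft Gt by simp
    have C: "0 \<le> C" using \<epsilon>(1) by (rule C_nonneg)
    define b where "b = mat_norm2 (mat_inv T)"
    have b: "0 \<le> b" by (simp add: b_def)
    have "C * (2 + C) \<le> ?K" "C \<le> ?K" using C by simp_all
    then have K: "C * (2 + C) * (b * \<epsilon>) \<le> ?K * (b * \<epsilon>)" "C * \<epsilon> \<le> ?K * \<epsilon>"
      using b \<epsilon> by (intro mult_right_mono; simp)+
    note F = residual_u[OF assms]
    have F_bound: "mat_norm2 (Ft + transpose_mat (pad m p) *
        ((1\<^sub>m (m + p) - Q * transpose_mat Q) * (Gt * pad k 1 * mat_inv T))) \<le> ?K * (b * \<epsilon>)"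
      using F(3) residual_bound_absorb[OF assms \<epsilon>] K(1) unfolding b_def by linarith
    have G_bound: "mat_norm2 (transpose_mat Q * Gt) \<le> ?K * \<epsilon>"
      using mat_norm2_residual_vt_le K(2) by linarith
    show "let Q = QA @\<^sub>r QL;
           v = (\<lambda>i. transpose_mat Q *\<^sub>v vt i);
           U = cols_upto m u (k + 1);
           V = cols_upto n v k;
           B = lower_bidiag \<alpha> \<beta> k;
           G = transpose_mat Q * Gt
       in \<exists>F \<in> carrier_mat m k.
            QA * V = U * B + F \<and>
            transpose_mat QA * U
              = V * transpose_mat B + \<alpha> (k + 1) \<cdot>\<^sub>m outer (v (k + 1)) (last_unit (k + 1)) + G \<and>
            mat_norm2 F \<le> ?K * (mat_norm2 (mat_inv (upper_bidiag \<alpha> \<beta> k)) * \<epsilon>) \<and>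
            mat_norm2 G \<le> ?K * \<epsilon>"
      unfolding Let_def V_eq
      by (intro bexI[OF _ F(2)] conjI F(1) recurrence_QA_transpose F_bound[unfolded b_def] G_bound)
  qed simp
qed

end
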